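(* Let $X$ be a topological space, let $I=[a,b]\subset\mathbb{R}$ be a compact interval with $a<b$, and let $\varphi,\psi,\omega:X\to\mathbb{R}$ and $\alpha,\beta:I\to\mathbb{R}$ be continuous functions. Define $\Phi:X\to]-\infty,+\infty]$ by $$\Phi(x)=\sup_{\lambda\in I}\left(\alpha(\lambda)\varphi(x)+\beta(\lambda)\psi(x)+\omega(x)\right).$$ Assume that: $(i_1)$ there exists a set $D\subseteq I$, dense in $I$, such that, for each $\lambda\in D$, the function $\alpha(\lambda)\varphi(\cdot)+\beta(\lambda)\psi(\cdot)+\omega(\cdot)$ is inf-connected; $(i_2)$ the functions $\alpha,\beta$ are $C^1$ in $]a,b[$, $\alpha'(\lambda)\neq 0$ for all $\lambda\in]a,b[$, and the function $g:=\frac{\beta'}{\alpha'}$ is strictly monotone in $]a,b[$. Finally, assume that one of the following conditions holds: $(i_3)$ $g$ is increasing in $]a,b[$ and $\alpha'(\lambda)\psi(x)<0$ for all $(\lambda,x)\in\,]a,b[\,\times(X\setminus\psi^{-1}(0))$; $(i_4)$ $g$ is decreasing in $]a,b[$ and $\alpha'(\lambda)\psi(x)>0$ for all $(\lambda,x)\in\,]a,b[\,\times(X\setminus\psi^{-1}(0))$. Set $\gamma:=\inf_{]a,b[}g$, $\delta:=\sup_{]a,b[}g$ (possibly infinite), and let $h:\mathbb{R}\to[a,b]$ be defined by $$h(\mu)=\begin{cases} g^{-1}(\mu) & \text{if } \mu\in g(]a,b[),\\ a & \text{if } \mu\le\gamma \text{ and } (i_3) \text{ holds, or } \mu\ge\delta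 \text{ and } (i_4) \text{ holds},\\ b & \text{if } \mu\le\gamma \text{ and } (i_4) \text{ holds, or } \mu\ge\delta \text{ and } (i_3) \text{ holds}.\end{cases}$$ Then $$\Phi(x)=\begin{cases}\alpha\left(h\left(-\frac{\varphi(x)}{\psi(x)}\right)\right)\varphi(x)+\beta\left(h\left(-\frac{\varphi(x)}{\psi(x)}\right)\right)\psi(x)+\omega(x) & \text{if } x\in X\setminus\psi^{-1}(0),\\ \max\{\alpha(a)\varphi(x),\alpha(b)\varphi(x)\}+\omega(x) & \text{if } x\in\psi^{-1}(0),\end{cases}$$ and $$\inf_X\Phi=\sup_{\lambda\in I}\inf_{x\in X}\left(\alpha(\lambda)\varphi(x)+\beta(\lambda)\psi(x)+\omega(x)\right).$$
   Context: $]a,b[$ denotes the open interval. A function $\eta:Y\to\mathbb{R}$ on a topological space $Y$ is called inf-connected if, for each $r\in\mathbb{R}$, the set $\eta^{-1}(]-\infty,r[)$ is connected (the empty set is regarded as connected). Infima and suprema are taken in the extended real line. *)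

theory Defs
  imports "HOL-Analysis.Analysis"
begin

text \<open>Topological spaces are rendered as \<open>'a topology\<close>, so the space may be empty and need not be
  the whole type; functions on it are only constrained on its carrier. Infima and suprema are
  taken in \<^typ>\<open>ereal\<close>.\<close>

definition inf_connected :: "'a topology \<Rightarrow> ('a \<Rightarrow> real) \<Rightarrow> bool" where
  "inf_connected Y \<eta> \<longleftrightarrow> (\<forall>r. connectedin Y {y \<in> topspace Y. \<eta> y < r})"

definition family ::
  "(real \<Rightarrow> real) \<Rightarrow> (real \<Rightarrow> real) \<Rightarrow> ('a \<Rightarrow> real) \<Rightarrow> ('a \<Rightarrow> real) \<Rightarrow> ('a \<Rightarrow> real) \<Rightarrow> real \<Rightarrow> 'a \<Rightarrow> real"
  where "family \<alpha> \<beta> \<phi> \<psi> \<omega> l x = \<alpha> l * \<phi> x + \<beta> l * \<psi> x + \<omega> x"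

definition sup_family ::
  "real \<Rightarrow> real \<Rightarrow> (real \<Rightarrow> real) \<Rightarrow> (real \<Rightarrow> real) \<Rightarrow> ('a \<Rightarrow> real) \<Rightarrow> ('a \<Rightarrow> real) \<Rightarrow> ('a \<Rightarrow> real) \<Rightarrow> 'a \<Rightarrow> ereal"
  where "sup_family a b \<alpha> \<beta> \<phi> \<psi> \<omega> x = (SUP l\<in>{a..b}. ereal (family \<alpha> \<beta> \<phi> \<psi> \<omega> l x))"

definition deriv_ratio :: "(real \<Rightarrow> real) \<Rightarrow> (real \<Rightarrow> real) \<Rightarrow> real \<Rightarrow> real" where
  "deriv_ratio \<alpha> \<beta> l = deriv \<beta> l / deriv \<alpha> l"

definition increasing_case ::
  "'a topology \<Rightarrow> real \<Rightarrow> real \<Rightarrow> (real \<Rightarrow> real) \<Rightarrow> (real \<Rightarrow> real) \<Rightarrow> ('a \<Rightarrow> real) \<Rightarrow> bool" where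
  "increasing_case X a b \<alpha> \<beta> \<psi> \<longleftrightarrow>
     mono_on {a<..<b} (deriv_ratio \<alpha> \<beta>) \<and>
     (\<forall>l\<in>{a<..<b}. \<forall>x\<in>topspace X. \<psi> x \<noteq> 0 \<longrightarrow> deriv \<alpha> l * \<psi> x < 0)"

definition decreasing_case ::
  "'a topology \<Rightarrow> real \<Rightarrow> real \<Rightarrow> (real \<Rightarrow> real) \<Rightarrow> (real \<Rightarrow> real) \<Rightarrow> ('a \<Rightarrow> real) \<Rightarrow> bool" where
  "decreasing_case X a b \<alpha> \<beta> \<psi> \<longleftrightarrow>
     antimono_on {a<..<b} (deriv_ratio \<alpha> \<beta>) \<and>
     (\<forall>l\<in>{a<..<b}. \<forall>x\<in>topspace X. \<psi> x \<noteq> 0 \<longrightarrow> deriv \<alpha> l * \<psi> x > 0)"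

text \<open>Below, \<open>\<gamma>\<close> and \<open>\<delta>\<close> may be infinite. If the derivative ratio is continuous and strictly
  monotone, its range is the open interval from \<open>\<gamma>\<close> to \<open>\<delta>\<close>, so the listed cases do not overlap,
  and if moreover one of the two sign cases holds, the last branch is never reached.\<close>

definition maximizer ::
  "'a topology \<Rightarrow> real \<Rightarrow> real \<Rightarrow> (real \<Rightarrow> real) \<Rightarrow> (real \<Rightarrow> real) \<Rightarrow> ('a \<Rightarrow> real) \<Rightarrow> real \<Rightarrow> real" where
  "maximizer X a b \<alpha> \<beta> \<psi> \<mu> =
     (let g = deriv_ratio \<alpha> \<beta>;
          \<gamma> = (INF l\<in>{a<..<b}. ereal (g l));
          \<delta> = (SUP l\<in>{a<..<b}. ereal (g l));
          incr = increasing_case X a b \<alpha> \<beta> \<psi>;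
          decr = decreasing_case X a b \<alpha> \<beta> \<psi>
      in if \<mu> \<in> g ` {a<..<b} then the_inv_into {a<..<b} g \<mu>
         else if (ereal \<mu> \<le> \<gamma> \<and> incr) \<or> (ereal \<mu> \<ge> \<delta> \<and> decr) then a
         else if (ereal \<mu> \<le> \<gamma> \<and> decr) \<or> (ereal \<mu> \<ge> \<delta> \<and> incr) then b
         else undefined)"

lemma maximizer_in_interval:
  assumes "a < b"
    and cont: "continuous_on {a<..<b} (deriv_ratio \<alpha> \<beta>)"
    and inj: "inj_on (deriv_ratio \<alpha> \<beta>) {a<..<b}"
    and cases: "increasing_case X a b \<alpha> \<beta> \<psi> \<or> decreasing_case X a b \<alpha> \<beta> \<psi>"
  shows "maximizer X a b \<alpha> \<beta> \<psi> \<mu> \<in> {a..b}"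
proof (cases "\<mu> \<in> deriv_ratio \<alpha> \<beta> ` {a<..<b}")
  case True
  then have "the_inv_into {a<..<b} (deriv_ratio \<alpha> \<beta>) \<mu> \<in> {a<..<b}"
    using inj by (metis the_inv_into_into order_refl)
  with True show ?thesis by (auto simp: maximizer_def Let_def)
next
  case False
  let ?g = "deriv_ratio \<alpha> \<beta>"
  have "is_interval (?g ` {a<..<b})"
    using connected_continuous_image[OF cont] by (simp add: is_interval_connected_1)
  with False have "(\<forall>l\<in>{a<..<b}. \<mu> \<le> ?g l) \<or> (\<forall>l\<in>{a<..<b}. ?g l \<le> \<mu>)"
    unfolding is_interval_1 by (meson imageI linear)
  then have "ereal \<mu> \<le> (INF l\<in>{a<..<b}. ereal (?g l)) \<or> (SUP l\<in>{a<..<b}. ereal (?g l)) \<le> ereal \<mu>"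
    by (auto intro!: INF_greatest SUP_least)
  with False cases \<open>a < b\<close> show ?thesis by (auto simp: maximizer_def Let_def)
qed

end

(* In (i3) and (i4) alike, the derivative alpha' psi (g + phi/psi) of the family with respect to the
   parameter passes from nonnegative to nonpositive at h(-phi/psi), so the family is quasi-concave in
   the parameter and attains its maximum there.

   For the minimax equality, suppose that some r lies strictly between the two sides. Each sublevel
   set {x. f l x < r} is nonempty, and by quasi-concavity it splits into two disjoint open pieces,
   according to the side of l on which f _ x exceeds r. The sets of parameters for which
   the first, respectively the second, piece is nonempty are open, nonempty and cover the connected
   interval, so they meet in a nonempty open set, hence at a point of the dense set. The sublevel set
   is disconnected there. *)

theory Submission
  imports Defs
begin

section \<open>Minimax equality for families quasi-concave in a real parameter\<close>

lemma minimax_inf_connected: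
  fixes X :: "'a topology" and a b :: real and f :: "real \<Rightarrow> 'a \<Rightarrow> real"
  assumes "a \<le> b"
    and contX: "\<And>l. l \<in> {a..b} \<Longrightarrow> continuous_map X euclideanreal (f l)"
    and contI: "\<And>x. x \<in> topspace X \<Longrightarrow> continuous_on {a..b} (\<lambda>l. f l x)"
    and quasiconcave: "\<And>x k l m. x \<in> topspace X \<Longrightarrow> a \<le> k \<Longrightarrow> k \<le> l \<Longrightarrow> l \<le> m \<Longrightarrow> m \<le> b
      \<Longrightarrow> min (f k x) (f m x) \<le> f l x"
    and "D \<subseteq> {a..b}" and dense: "{a..b} \<subseteq> closure D"
    and conn: "\<And>l. l \<in> D \<Longrightarrow> inf_connected X (f l)"
  shows "(INF x\<in>topspace X. SUP l\<in>{a..b}. ereal (f l x))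
       = (SUP l\<in>{a..b}. INF x\<in>topspace X. ereal (f l x))"
proof (rule antisym)
  show "(SUP l\<in>{a..b}. INF x\<in>topspace X. ereal (f l x))
      \<le> (INF x\<in>topspace X. SUP l\<in>{a..b}. ereal (f l x))"
    by (intro SUP_least INF_greatest) (rule order_trans[OF INF_lower SUP_upper])
next
  show "(INF x\<in>topspace X. SUP l\<in>{a..b}. ereal (f l x))
      \<le> (SUP l\<in>{a..b}. INF x\<in>topspace X. ereal (f l x))"
  proof (rule ccontr)
    assume "\<not> ?thesis"
    then obtain r :: real
      where lower: "(SUP l\<in>{a..b}. INF x\<in>topspace X. ereal (f l x)) < ereal r"
        and upper: "ereal r < (INF x\<in>topspace X. SUP l\<in>{a..b}. ereal (f l x))"
      using ereal_dense2 by (metis not_le)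
    \<comment> \<open>The two strict bounds on \<open>r\<close> become pointwise facts: every
      parameter has a point below \<open>r\<close>, and every point has a parameter at which it
      exceeds \<open>r\<close>.\<close>
    have sublevel: "\<exists>x\<in>topspace X. f l x < r" if "l \<in> {a..b}" for l
    proof -
      have "(INF x\<in>topspace X. ereal (f l x)) < ereal r"
        using lower SUP_upper[OF that, of "\<lambda>l. INF x\<in>topspace X. ereal (f l x)"]
        by (rule le_less_trans[rotated])
      then show ?thesis by (auto simp: INF_less_iff)
    qed
    have superlevel: "\<exists>m\<in>{a..b}. r < f m x" if "x \<in> topspace X" for x
    proof -
      have "ereal r < (SUP l\<in>{a..b}. ereal (f l x))"
        using upper INF_lower[OF that, of "\<lambda>x. SUP l\<in>{a..b}. ereal (f l x)"]
        by (rule less_le_trans)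
      then show ?thesis by (auto simp: less_SUP_iff)
    qed
    \<comment> \<open>Both comparisons with \<open>r\<close> are strict, so that the pieces are open
      in \<open>X\<close> and \<open>P\<close>, \<open>Q\<close> are relatively open in the
      interval.\<close>
    define L where "L l = {x \<in> topspace X. f l x < r \<and> (\<exists>m\<in>{a..b}. l < m \<and> r < f m x)}" for l
    define R where "R l = {x \<in> topspace X. f l x < r \<and> (\<exists>m\<in>{a..b}. m < l \<and> r < f m x)}" for l
    define P where "P = {l \<in> {a..b}. L l \<noteq> {}}"
    define Q where "Q = {l \<in> {a..b}. R l \<noteq> {}}"
    have split: "{x \<in> topspace X. f l x < r} = L l \<union> R l" for l
    proof -
      have "x \<in> L l \<union> R l" if x: "x \<in> topspace X" "f l x < r" for x
      proof -
        obtain m where "m \<in> {a..b}" "r < f m x" using superlevel x by blast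
        moreover from this x have "l < m \<or> m < l" by (metis less_asym linorder_neqE)
        ultimately show ?thesis using x by (auto simp: L_def R_def)
      qed
      then show ?thesis by (auto simp: L_def R_def)
    qed
    \<comment> \<open>If \<open>f _ x\<close> exceeded \<open>r\<close> on both sides of
      \<open>l\<close>, quasi-concavity would force \<open>f l x > r\<close> as well.\<close>
    have disjoint: "L l \<inter> R l = {}" for l
    proof -
      have False if "x \<in> L l" "x \<in> R l" for x
      proof -
        from that obtain k m where "k \<in> {a..b}" "m \<in> {a..b}" "k < l" "l < m"
          "r < f k x" "r < f m x" "f l x < r" "x \<in> topspace X"
          by (auto simp: L_def R_def)
        then show False using quasiconcave[of x k l m] by auto
      qed
      then show ?thesis by blast
    qed
    have openX: "openin X {x \<in> topspace X. f l x < r}" "openin X {x \<in> topspace X. r < f l x}"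
      if "l \<in> {a..b}" for l
      using contX[OF that] by (simp_all add: continuous_map_upper_lower_semicontinuous_lt)
    have openL: "openin X (L l)" if "l \<in> {a..b}" for l
    proof -
      have "L l = (\<Union>m\<in>{a..b} \<inter> {l<..}. {x \<in> topspace X. f l x < r} \<inter> {x \<in> topspace X. r < f m x})"
        by (auto simp: L_def)
      then show ?thesis using openX that by (auto intro!: openin_Union)
    qed
    have openR: "openin X (R l)" if "l \<in> {a..b}" for l
    proof -
      have "R l = (\<Union>m\<in>{a..b} \<inter> {..<l}. {x \<in> topspace X. f l x < r} \<inter> {x \<in> topspace X. r < f m x})"
        by (auto simp: R_def)
      then show ?thesis using openX that by (auto intro!: openin_Union)
    qed
    have openI: "openin (top_of_set {a..b}) {l \<in> {a..b}. f l x < r}" if "x \<in> topspace X" for x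
      using contI[OF that]
      by (simp add: continuous_map_upper_lower_semicontinuous_lt flip: continuous_map_iff_continuous)
    \<comment> \<open>For a fixed point \<open>x\<close> and a fixed witness \<open>m\<close>,
      membership of \<open>x\<close> in \<open>L l\<close> only asks that \<open>f l x < r\<close>
      and \<open>l < m\<close>, a relatively open condition on \<open>l\<close>.\<close>
    have openP: "openin (top_of_set {a..b}) P"
    proof -
      have "P = (\<Union>x\<in>topspace X. \<Union>m\<in>{m \<in> {a..b}. r < f m x}.
                   {l \<in> {a..b}. f l x < r} \<inter> {..<m})"
        unfolding P_def L_def by blast
      then show ?thesis using openI by (auto intro!: openin_Union openin_Int_open)
    qed
    have openQ: "openin (top_of_set {a..b}) Q"
    proof -
      have "Q = (\<Union>x\<in>topspace X. \<Union>m\<in>{m \<in> {a..b}. r < f m x}.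
                   {l \<in> {a..b}. f l x < r} \<inter> {m<..})"
        unfolding Q_def R_def by blast
      then show ?thesis using openI by (auto intro!: openin_Union openin_Int_open)
    qed
    have cover: "L l \<noteq> {} \<or> R l \<noteq> {}" if "l \<in> {a..b}" for l
      using sublevel[OF that] split[of l] by auto
    \<comment> \<open>No parameter lies left of \<open>a\<close> or right of \<open>b\<close>, so
      the nonempty sublevel sets at the ends are \<open>L a\<close> and \<open>R b\<close>; hence
      \<open>a\<close> is in \<open>P\<close> and \<open>b\<close> in \<open>Q\<close>.\<close>
    have "R a = {}" "L b = {}" by (auto simp: L_def R_def)
    with cover \<open>a \<le> b\<close> have "P \<noteq> {}" "Q \<noteq> {}" by (auto simp: P_def Q_def)
    moreover have "{a..b} \<subseteq> P \<union> Q" using cover by (auto simp: P_def Q_def)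
    ultimately have "P \<inter> Q \<noteq> {}"
      using openP openQ connected_Icc[of a b] unfolding connected_openin by blast
    \<comment> \<open>Connectedness yields just one common point, which may lie outside
      \<open>D\<close>. Since the intersection is relatively open, density moves it into
      \<open>D\<close>.\<close>
    moreover obtain T where T: "open T" "P \<inter> Q = {a..b} \<inter> T"
      using openin_Int[OF openP openQ] by (auto simp: openin_open)
    ultimately have "T \<inter> closure D \<noteq> {}" using dense by blast
    then have "T \<inter> D \<noteq> {}" using open_Int_closure_eq_empty[OF \<open>open T\<close>] by blast
    then obtain l where "l \<in> D" "l \<in> P \<inter> Q"
      using T(2) \<open>D \<subseteq> {a..b}\<close> by blast
    then have l: "l \<in> D" "l \<in> {a..b}" "L l \<noteq> {}" "R l \<noteq> {}"
      by (auto simp: P_def Q_def)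
    have "connectedin X (L l \<union> R l)"
      using conn[OF l(1)] by (simp add: inf_connected_def split[symmetric])
    then show False
      by (rule connectedinD[OF _ openL[OF l(2)] openR[OF l(2)]])
        (use disjoint[of l] l(3,4) in auto)
  qed
qed

section \<open>Calculus in the parameter: constant signs, unimodality, and the sign of the
  derivative around the maximizer\<close>

lemma nonzero_imp_constant_sign:
  fixes f :: "real \<Rightarrow> real"
  assumes "continuous_on S f" "connected S" "\<And>x. x \<in> S \<Longrightarrow> f x \<noteq> 0"
  shows "(\<forall>x\<in>S. 0 < f x) \<or> (\<forall>x\<in>S. f x < 0)"
proof -
  have interval: "is_interval (f ` S)"
    using connected_continuous_image[OF assms(1,2)] by (simp add: is_interval_connected_1)
  have False if "x \<in> S" "y \<in> S" "f x \<le> 0" "0 \<le> f y" for x y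
  proof -
    have "0 \<in> f ` S" using mem_is_interval_1_I[OF interval, of "f x" "f y" 0] that by blast
    then show False using assms(3) by auto
  qed
  then show ?thesis by (meson less_imp_le not_le)
qed

text \<open>\<open>C1_differentiable_on\<close> only asserts that some continuous derivative exists;
  uniqueness of derivatives identifies it with \<open>deriv\<close>, in which
  \<open>deriv_ratio\<close> is phrased.\<close>

lemma C1_differentiable_on_deriv:
  fixes f :: "real \<Rightarrow> real"
  assumes "f C1_differentiable_on S"
  shows "\<And>x. x \<in> S \<Longrightarrow> (f has_real_derivative deriv f x) (at x)" "continuous_on S (deriv f)"
proof -
  obtain D where D: "\<And>x. x \<in> S \<Longrightarrow> (f has_real_derivative D x) (at x)" "continuous_on S D"
    using assms unfolding C1_differentiable_on_def has_real_derivative_iff_has_vector_derivative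
    by blast
  then have "deriv f x = D x" if "x \<in> S" for x using that by (blast intro: DERIV_imp_deriv)
  then show "\<And>x. x \<in> S \<Longrightarrow> (f has_real_derivative deriv f x) (at x)" "continuous_on S (deriv f)"
    using D by (auto simp: cong: continuous_on_cong_simp)
qed

text \<open>One notion that yields both the value of the supremum and quasi-concavity. The peak may
  be an endpoint and need not be unique, so constant functions are included.\<close>

definition unimodal :: "real \<Rightarrow> real \<Rightarrow> (real \<Rightarrow> real) \<Rightarrow> real \<Rightarrow> bool" where
  "unimodal a b F m \<longleftrightarrow> m \<in> {a..b} \<and> mono_on {a..m} F \<and> antimono_on {m..b} F"

text \<open>The derivative is controlled only inside the interval and away from \<open>m\<close>;
  continuity on the closed interval carries monotonicity over to the endpoints and to
  \<open>m\<close>.\<close>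

lemma unimodalI_deriv:
  assumes "m \<in> {a..b}" and cont: "continuous_on {a..b} F"
    and deriv: "\<And>l. l \<in> {a<..<b} \<Longrightarrow> (F has_real_derivative F' l) (at l)"
    and nonneg: "\<And>l. l \<in> {a<..<b} \<Longrightarrow> l < m \<Longrightarrow> 0 \<le> F' l"
    and nonpos: "\<And>l. l \<in> {a<..<b} \<Longrightarrow> m < l \<Longrightarrow> F' l \<le> 0"
  shows "unimodal a b F m"
  unfolding unimodal_def
proof (intro conjI)
  show "mono_on {a..m} F"
  proof (rule mono_onI)
    fix k l assume "k \<in> {a..m}" "l \<in> {a..m}" "k \<le> l"
    with assms(1) show "F k \<le> F l"
      by (intro DERIV_nonneg_imp_increasing_open[OF \<open>k \<le> l\<close>] continuous_on_subset[OF cont])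
        (auto intro!: exI deriv nonneg)
  qed
  show "antimono_on {m..b} F"
  proof (rule monotone_onI)
    fix k l assume "k \<in> {m..b}" "l \<in> {m..b}" "k \<le> l"
    with assms(1) show "F l \<le> F k"
      by (intro DERIV_nonpos_imp_decreasing_open[OF \<open>k \<le> l\<close>] continuous_on_subset[OF cont])
        (auto intro!: exI deriv nonpos)
  qed
qed fact

lemma unimodal_SUP:
  assumes "unimodal a b F m"
  shows "(SUP l\<in>{a..b}. ereal (F l)) = ereal (F m)"
proof (rule SUP_eqI)
  show "ereal (F l) \<le> ereal (F m)" if "l \<in> {a..b}" for l
    using assms that by (cases "l \<le> m") (auto simp: unimodal_def monotone_on_def)
next
  show "ereal (F m) \<le> y" if "\<And>l. l \<in> {a..b} \<Longrightarrow> ereal (F l) \<le> y" for y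
    using assms that by (auto simp: unimodal_def)
qed

lemma unimodal_quasiconcave:
  assumes "unimodal a b F p" "a \<le> k" "k \<le> l" "l \<le> m" "m \<le> b"
  shows "min (F k) (F m) \<le> F l"
proof (cases "l \<le> p")
  case True
  then have "F k \<le> F l" using assms by (auto simp: unimodal_def monotone_on_def)
  then show ?thesis by simp
next
  case False
  then have "F m \<le> F l" using assms by (auto simp: unimodal_def monotone_on_def)
  then show ?thesis by simp
qed

text \<open>For \<open>\<mu> = - (\<phi> x / \<psi> x)\<close>, \<open>s\<close> is the derivative
  of the family at \<open>l\<close>. The factor \<open>deriv \<alpha> l * \<psi> x\<close> has a
  known sign in each case, so it remains to compare \<open>deriv_ratio \<alpha> \<beta> l\<close>
  with \<open>\<mu>\<close>, and \<open>m\<close> is where that comparison switches, or an endpoint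
  if it never does.\<close>

lemma maximizer_deriv_sign:
  fixes \<mu> :: real
  assumes "a < b"
    and cont: "continuous_on {a<..<b} (deriv_ratio \<alpha> \<beta>)"
    and inj: "inj_on (deriv_ratio \<alpha> \<beta>) {a<..<b}"
    and cases: "increasing_case X a b \<alpha> \<beta> \<psi> \<or> decreasing_case X a b \<alpha> \<beta> \<psi>"
    and x: "x \<in> topspace X" "\<psi> x \<noteq> 0"
    and l: "l \<in> {a<..<b}"
  defines "m \<equiv> maximizer X a b \<alpha> \<beta> \<psi> \<mu>"
    and "s \<equiv> deriv \<alpha> l * \<psi> x * (deriv_ratio \<alpha> \<beta> l - \<mu>)"
  shows "l < m \<Longrightarrow> 0 \<le> s" "m < l \<Longrightarrow> s \<le> 0"
proof -
  let ?g = "deriv_ratio \<alpha> \<beta>"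
  let ?I = "increasing_case X a b \<alpha> \<beta> \<psi>" and ?D = "decreasing_case X a b \<alpha> \<beta> \<psi>"
  \<comment> \<open>The given \<open>x\<close> and \<open>l\<close> fix the sign of
    \<open>deriv \<alpha> l * \<psi> x\<close>, so the endpoint chosen by \<open>maximizer\<close>
    is unambiguous.\<close>
  have exclusive: "\<not> (?I \<and> ?D)"
    using x l unfolding increasing_case_def decreasing_case_def by (meson less_asym)
  have sign: "?I \<Longrightarrow> deriv \<alpha> l * \<psi> x < 0" "?D \<Longrightarrow> 0 < deriv \<alpha> l * \<psi> x"
    using x l by (auto simp: increasing_case_def decreasing_case_def)
  have s_incr: "?I \<Longrightarrow> ?g l \<le> \<mu> \<Longrightarrow> 0 \<le> s" "?I \<Longrightarrow> \<mu> \<le> ?g l \<Longrightarrow> s \<le> 0"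
    using sign unfolding s_def by (auto intro: mult_nonpos_nonpos mult_nonpos_nonneg)
  have s_decr: "?D \<Longrightarrow> \<mu> \<le> ?g l \<Longrightarrow> 0 \<le> s" "?D \<Longrightarrow> ?g l \<le> \<mu> \<Longrightarrow> s \<le> 0"
    using sign unfolding s_def by (auto intro: mult_nonneg_nonneg mult_nonneg_nonpos)
  have mono: "?I \<Longrightarrow> mono_on {a<..<b} ?g" "?D \<Longrightarrow> antimono_on {a<..<b} ?g"
    by (auto simp: increasing_case_def decreasing_case_def)
  \<comment> \<open>If \<open>?g\<close> misses \<open>\<mu>\<close>, then \<open>?g - \<mu>\<close>
    is continuous without zeros on an interval, hence of one sign.\<close>
  consider (range) p where "p \<in> {a<..<b}" "\<mu> = ?g p" | (below) "\<forall>k\<in>{a<..<b}. \<mu> < ?g k"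
    | (above) "\<forall>k\<in>{a<..<b}. ?g k < \<mu>"
  proof (cases "\<mu> \<in> ?g ` {a<..<b}")
    case False
    have "(\<forall>k\<in>{a<..<b}. 0 < ?g k - \<mu>) \<or> (\<forall>k\<in>{a<..<b}. ?g k - \<mu> < 0)"
      using False by (intro nonzero_imp_constant_sign continuous_intros cont) auto
    then show ?thesis using below above by auto
  qed (use range in blast)
  then have "(l < m \<longrightarrow> 0 \<le> s) \<and> (m < l \<longrightarrow> s \<le> 0)"
  proof cases
    case range
    then have "m = p"
      using inj by (auto simp: m_def maximizer_def the_inv_into_f_f)
    with range l cases mono have "(?I \<longrightarrow> (l < m \<longrightarrow> ?g l \<le> \<mu>) \<and> (m < l \<longrightarrow> \<mu> \<le> ?g l)) \<and>
       (?D \<longrightarrow> (l < m \<longrightarrow> \<mu> \<le> ?g l) \<and> (m < l \<longrightarrow> ?g l \<le> \<mu>))"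
      by (auto simp: monotone_on_def)
    with cases s_incr s_decr show ?thesis by blast
  next
    case below
    have "\<mu> \<notin> ?g ` {a<..<b}" using below by auto
    moreover have "ereal \<mu> \<le> (INF k\<in>{a<..<b}. ereal (?g k))"
      using below by (intro INF_greatest) (auto intro: less_imp_le)
    \<comment> \<open>This excludes the branches for \<open>\<mu>\<close> at or above the supremum,
      one of which is tested before the branch wanted in the decreasing case.\<close>
    moreover have "\<not> (SUP k\<in>{a<..<b}. ereal (?g k)) \<le> ereal \<mu>"
      using below l by (auto simp: SUP_le_iff not_le)
    ultimately have "m = (if ?I then a else b)"
      using exclusive cases by (auto simp: m_def maximizer_def Let_def)
    \<comment> \<open>With \<open>m\<close> an endpoint and \<open>l\<close> interior, one of the
      two implications is vacuous; this inequality settles the other.\<close>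
    moreover have "\<mu> < ?g l" using below l by blast
    ultimately show ?thesis
      using cases s_incr s_decr l by (auto split: if_splits)
  next
    case above
    have "\<mu> \<notin> ?g ` {a<..<b}" using above by auto
    moreover have "(SUP k\<in>{a<..<b}. ereal (?g k)) \<le> ereal \<mu>"
      using above by (intro SUP_least) (auto intro: less_imp_le)
    moreover have "\<not> ereal \<mu> \<le> (INF k\<in>{a<..<b}. ereal (?g k))"
      using above l by (auto simp: le_INF_iff not_le)
    ultimately have "m = (if ?I then b else a)"
      using exclusive cases by (auto simp: m_def maximizer_def Let_def)
    moreover have "?g l < \<mu>" using above l by blast
    ultimately show ?thesis
      using cases s_incr s_decr l by (auto split: if_splits)
  qed
  then show "l < m \<Longrightarrow> 0 \<le> s" "m < l \<Longrightarrow> s \<le> 0" by auto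
qed

section \<open>Application to the given family: the closed form of the supremum, then the minimax
  equality\<close>

theorem theorem1p1:
  fixes X :: "'a topology"
    and a b :: real
    and \<phi> \<psi> \<omega> :: "'a \<Rightarrow> real"
    and \<alpha> \<beta> :: "real \<Rightarrow> real"
  assumes "a < b"
    and "continuous_map X euclideanreal \<phi>"
    and "continuous_map X euclideanreal \<psi>"
    and "continuous_map X euclideanreal \<omega>"
    and "continuous_on {a..b} \<alpha>"
    and "continuous_on {a..b} \<beta>"
    and i1: "\<exists>D. D \<subseteq> {a..b} \<and> {a..b} \<subseteq> closure D \<and>
               (\<forall>l\<in>D. inf_connected X (\<lambda>x. family \<alpha> \<beta> \<phi> \<psi> \<omega> l x))"
    and i2: "\<alpha> C1_differentiable_on {a<..<b}"
            "\<beta> C1_differentiable_on {a<..<b}"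
            "\<forall>l\<in>{a<..<b}. deriv \<alpha> l \<noteq> 0"
            "strict_mono_on {a<..<b} (deriv_ratio \<alpha> \<beta>) \<or>
             strict_antimono_on {a<..<b} (deriv_ratio \<alpha> \<beta>)"
    and i3_or_i4: "increasing_case X a b \<alpha> \<beta> \<psi> \<or> decreasing_case X a b \<alpha> \<beta> \<psi>"
  shows "(\<forall>x\<in>topspace X.
            sup_family a b \<alpha> \<beta> \<phi> \<psi> \<omega> x =
              (if \<psi> x \<noteq> 0
               then ereal (\<alpha> (maximizer X a b \<alpha> \<beta> \<psi> (- (\<phi> x / \<psi> x))) * \<phi> x
                         + \<beta> (maximizer X a b \<alpha> \<beta> \<psi> (- (\<phi> x / \<psi> x))) * \<psi> x + \<omega> x)
               else ereal (max (\<alpha> a * \<phi> x) (\<alpha> b * \<phi> x) + \<omega> x)))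
       \<and> (INF x\<in>topspace X. sup_family a b \<alpha> \<beta> \<phi> \<psi> \<omega> x)
           = (SUP l\<in>{a..b}. INF x\<in>topspace X. ereal (family \<alpha> \<beta> \<phi> \<psi> \<omega> l x))"
proof -
  let ?f = "family \<alpha> \<beta> \<phi> \<psi> \<omega>"
  let ?g = "deriv_ratio \<alpha> \<beta>"
  note C1_\<alpha> = C1_differentiable_on_deriv[OF i2(1)]
  note C1_\<beta> = C1_differentiable_on_deriv[OF i2(2)]
  have cont_g: "continuous_on {a<..<b} ?g"
    unfolding deriv_ratio_def using C1_\<alpha>(2) C1_\<beta>(2) i2(3) by (intro continuous_intros) auto
  have inj_g: "inj_on ?g {a<..<b}"
    using i2(4) by (intro linorder_inj_onI') (fastforce simp: monotone_on_def)+
  have contI: "continuous_on {a..b} (\<lambda>l. ?f l x)" for x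
    unfolding family_def by (intro continuous_intros assms)
  have contX: "continuous_map X euclideanreal (?f l)" for l
    unfolding family_def by (intro continuous_intros assms)
  have deriv_f: "((\<lambda>l. ?f l x) has_real_derivative deriv \<alpha> l * \<phi> x + deriv \<beta> l * \<psi> x) (at l)"
    if "l \<in> {a<..<b}" for l x
    unfolding family_def using C1_\<alpha>(1)[OF that] C1_\<beta>(1)[OF that]
    by (auto intro!: derivative_eq_intros)
  have unimodal_nonzero: "unimodal a b (\<lambda>l. ?f l x) (maximizer X a b \<alpha> \<beta> \<psi> (- (\<phi> x / \<psi> x)))"
    if x: "x \<in> topspace X" "\<psi> x \<noteq> 0" for x
  proof (rule unimodalI_deriv[OF _ contI deriv_f])
    show "maximizer X a b \<alpha> \<beta> \<psi> (- (\<phi> x / \<psi> x)) \<in> {a..b}"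
      using \<open>a < b\<close> cont_g inj_g i3_or_i4 by (rule maximizer_in_interval)
    fix l assume l: "l \<in> {a<..<b}"
    \<comment> \<open>Dividing by \<open>deriv \<alpha> l\<close> and by \<open>\<psi> x\<close>,
      both nonzero, brings the derivative into the shape whose sign is known.\<close>
    have eq: "deriv \<alpha> l * \<phi> x + deriv \<beta> l * \<psi> x
        = deriv \<alpha> l * \<psi> x * (?g l - (- (\<phi> x / \<psi> x)))"
      using i2(3) l x by (simp add: deriv_ratio_def field_simps)
    note sign = maximizer_deriv_sign[OF \<open>a < b\<close> cont_g inj_g i3_or_i4 x l, of "- (\<phi> x / \<psi> x)"]
    show "0 \<le> deriv \<alpha> l * \<phi> x + deriv \<beta> l * \<psi> x"
      if "l < maximizer X a b \<alpha> \<beta> \<psi> (- (\<phi> x / \<psi> x))"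
      unfolding eq using that by (rule sign)
    show "deriv \<alpha> l * \<phi> x + deriv \<beta> l * \<psi> x \<le> 0"
      if "maximizer X a b \<alpha> \<beta> \<psi> (- (\<phi> x / \<psi> x)) < l"
      unfolding eq using that by (rule sign)
  qed
  \<comment> \<open>Where \<open>\<psi> x = 0\<close> the derivative in the parameter reduces to
    \<open>deriv \<alpha> l * \<phi> x\<close>. Its sign does not change, so the family is monotone
    and peaks at an end.\<close>
  have \<alpha>_sign: "(\<forall>l\<in>{a<..<b}. 0 < deriv \<alpha> l) \<or> (\<forall>l\<in>{a<..<b}. deriv \<alpha> l < 0)"
    using C1_\<alpha>(2) i2(3) by (intro nonzero_imp_constant_sign) auto
  have unimodal_zero: "unimodal a b (\<lambda>l. ?f l x) a \<or> unimodal a b (\<lambda>l. ?f l x) b"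
    if "\<psi> x = 0" for x
  proof -
    have "(\<forall>l\<in>{a<..<b}. 0 \<le> deriv \<alpha> l * \<phi> x) \<or> (\<forall>l\<in>{a<..<b}. deriv \<alpha> l * \<phi> x \<le> 0)"
      using \<alpha>_sign by (cases "0 \<le> \<phi> x") (auto simp: zero_le_mult_iff mult_le_0_iff)
    then show ?thesis
    proof
      assume "\<forall>l\<in>{a<..<b}. 0 \<le> deriv \<alpha> l * \<phi> x"
      then have "unimodal a b (\<lambda>l. ?f l x) b"
        using \<open>a < b\<close> that by (intro unimodalI_deriv[OF _ contI deriv_f]) auto
      then show ?thesis ..
    next
      assume "\<forall>l\<in>{a<..<b}. deriv \<alpha> l * \<phi> x \<le> 0"
      then have "unimodal a b (\<lambda>l. ?f l x) a"
        using \<open>a < b\<close> that by (intro unimodalI_deriv[OF _ contI deriv_f]) auto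
      then show ?thesis ..
    qed
  qed
  have sup_zero: "sup_family a b \<alpha> \<beta> \<phi> \<psi> \<omega> x = ereal (max (\<alpha> a * \<phi> x) (\<alpha> b * \<phi> x) + \<omega> x)"
    if "\<psi> x = 0" for x
  proof -
    \<comment> \<open>Both end values are lower bounds for the supremum and one of them equals it,
      so it is their maximum; which end peaks need not be decided.\<close>
    have ends: "ereal (?f a x) \<le> sup_family a b \<alpha> \<beta> \<phi> \<psi> \<omega> x"
      "ereal (?f b x) \<le> sup_family a b \<alpha> \<beta> \<phi> \<psi> \<omega> x"
      unfolding sup_family_def using \<open>a < b\<close> by (auto intro: SUP_upper)
    have "sup_family a b \<alpha> \<beta> \<phi> \<psi> \<omega> x = ereal (?f a x)
        \<or> sup_family a b \<alpha> \<beta> \<phi> \<psi> \<omega> x = ereal (?f b x)"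
      unfolding sup_family_def using unimodal_zero[OF that] by (auto dest: unimodal_SUP)
    with ends that show ?thesis by (auto simp: family_def)
  qed
  have sup_nonzero: "sup_family a b \<alpha> \<beta> \<phi> \<psi> \<omega> x
      = ereal (?f (maximizer X a b \<alpha> \<beta> \<psi> (- (\<phi> x / \<psi> x))) x)"
    if "x \<in> topspace X" "\<psi> x \<noteq> 0" for x
    unfolding sup_family_def using unimodal_SUP[OF unimodal_nonzero[OF that]] .
  have quasiconcave: "min (?f k x) (?f m x) \<le> ?f l x"
    if x: "x \<in> topspace X" and le: "a \<le> k" "k \<le> l" "l \<le> m" "m \<le> b" for x k l m
  proof -
    \<comment> \<open>The peak may vary with \<open>x\<close>, since quasi-concavity concerns one
      point at a time.\<close>
    obtain p where "unimodal a b (\<lambda>l. ?f l x) p"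
      using unimodal_nonzero[OF x] unimodal_zero by blast
    then show ?thesis using le by (rule unimodal_quasiconcave)
  qed
  obtain D where D: "D \<subseteq> {a..b}" "{a..b} \<subseteq> closure D" "\<And>l. l \<in> D \<Longrightarrow> inf_connected X (?f l)"
    using i1 by auto
  have "(INF x\<in>topspace X. sup_family a b \<alpha> \<beta> \<phi> \<psi> \<omega> x)
      = (SUP l\<in>{a..b}. INF x\<in>topspace X. ereal (?f l x))"
    unfolding sup_family_def
    using \<open>a < b\<close> D by (intro minimax_inf_connected contX contI quasiconcave) auto
  then show ?thesis
    using sup_zero sup_nonzero by (simp add: family_def)
qed

end
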